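(* Let $\mathcal F$ and $\mathcal G$ be two $\sigma$-algebras (sub-$\sigma$-algebras of the underlying probability space) such that, for all $A\in\mathcal F$ and $B\in\mathcal G$ with respective probabilities $p=\Pr[A]$ and $q=\Pr[B]$, $$\Pr[A\cap B]-pq\ \le\ \zeta(p)\,\theta(q)$$ for some (fixed) $\zeta,\theta\in\mathcal C^0_0[0,1]$. Then $$\{\mathcal F:\mathcal G\}\ \le\ \|\zeta\|_{H^1_0}\,\|\theta\|_{H^1_0}.$$
   Context: $\mathcal C^0_0[0,1]$ is the space of continuous functions $f:[0,1]\to\mathbb R$ with $f(0)=f(1)=0$. $H^1_0(0,1)$ is the completion of the space of smooth compactly supported functions on $(0,1)$ for the scalar product $\langle\phi,\psi\rangle_{H^1_0}=\int_0^1\phi'(x)\psi'(x)\,dx$; its elements are identified with functions of $\mathcal C^0_0[0,1]$ (so $\|f\|_{H^1_0}^2=\int_0^1 f'(x)^2\,dx$ with the weak derivative). If $f\in\mathcal C^0_0[0,1]$ does not correspond to an element of $H^1_0(0,1)$, one sets $\|f\|_{H^1_0}=+\infty$. The Hilbertian (maximal) correlation coefficient of $\mathcal F$ and $\mathcal G$ is $$\{\mathcal F:\mathcal G\}=\sup_{f,g}\frac{|\operatorname{Cov}(f,g)|}{\operatorname{sd}(f)\operatorname{sd}(g)},$$ the supremum being over real square-integrable, not a.s. constant $f$ ($\mathcal F$-measurable) and $g$ ($\mathcal G$-measurable), where $\operatorname{sd}$ denotes the standard deviation; it is $0$ if $\mathcal F$ or $\mathcal G$ is trivial. *)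

theory Defs
  imports "HOL-Probability.Probability"
begin

section \<open>The space of continuous functions vanishing at the endpoints\<close>

text \<open>
  Functions on \<open>[0,1]\<close> are represented by functions of type \<open>real \<Rightarrow> real\<close> of which only the values
  on \<open>{0..1}\<close> matter.
\<close>

definition C00 :: "(real \<Rightarrow> real) set" where
  "C00 = {f. continuous_on {0..1} f \<and> f 0 = 0 \<and> f 1 = 0}"


section \<open>The Sobolev space \<open>H\<^sup>1\<^sub>0(0,1)\<close> as a completion\<close>

text \<open>
  Smooth functions with compact support inside \<open>(0,1)\<close>, extended by \<open>0\<close> to the real line.
\<close>

definition test_functions :: "(real \<Rightarrow> real) set" where
  "test_functions =
     {\<phi>. (\<forall>k. (deriv ^^ k) \<phi> differentiable_on UNIV) \<and> closure {x. \<phi> x \<noteq> 0} \<subseteq> {0<..<1}}"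

definition h10_inner :: "(real \<Rightarrow> real) \<Rightarrow> (real \<Rightarrow> real) \<Rightarrow> real" where
  "h10_inner \<phi> \<psi> = integral {0..1} (\<lambda>x. deriv \<phi> x * deriv \<psi> x)"

definition h10_prenorm :: "(real \<Rightarrow> real) \<Rightarrow> real" where
  "h10_prenorm \<phi> = sqrt (h10_inner \<phi> \<phi>)"

definition h10_Cauchy :: "(nat \<Rightarrow> real \<Rightarrow> real) \<Rightarrow> bool" where
  "h10_Cauchy \<phi> \<longleftrightarrow> (\<forall>e>0. \<exists>N. \<forall>m\<ge>N. \<forall>n\<ge>N. h10_prenorm (\<lambda>x. \<phi> m x - \<phi> n x) < e)"

text \<open>
  An element of the completion is given by a Cauchy sequence of test functions. Since
  \<open>\<bar>\<phi> x\<bar> \<le> h10_prenorm \<phi>\<close> on \<open>{0..1}\<close>, such a sequence converges uniformly, and the element of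
  the completion is identified with its uniform limit.
\<close>

definition h10_represents :: "(nat \<Rightarrow> real \<Rightarrow> real) \<Rightarrow> (real \<Rightarrow> real) \<Rightarrow> bool" where
  "h10_represents \<phi> f \<longleftrightarrow>
     (\<forall>n. \<phi> n \<in> test_functions) \<and> h10_Cauchy \<phi> \<and> uniform_limit {0..1} \<phi> f sequentially"

definition h10_norm :: "(real \<Rightarrow> real) \<Rightarrow> ennreal" where
  "h10_norm f =
     (if \<exists>\<phi>. h10_represents \<phi> f
      then ennreal (THE L. \<exists>\<phi>. h10_represents \<phi> f \<and> (\<lambda>n. h10_prenorm (\<phi> n)) \<longlonglongrightarrow> L)
      else \<infinity>)"


subsection \<open>The norm does not depend on the representing sequence\<close>

lemma integral_Cauchy_Schwarz:
  fixes a b :: "real \<Rightarrow> real"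
  assumes a: "continuous_on {0..1} a" and b: "continuous_on {0..1} b"
  shows "\<bar>integral {0..1} (\<lambda>x. a x * b x)\<bar>
           \<le> sqrt (integral {0..1} (\<lambda>x. a x * a x)) * sqrt (integral {0..1} (\<lambda>x. b x * b x))"
proof -
  define A B C where "A = integral {0..1} (\<lambda>x. a x * a x)"
    and "B = integral {0..1} (\<lambda>x. b x * b x)" and "C = integral {0..1} (\<lambda>x. a x * b x)"
  have hA: "((\<lambda>x. a x * a x) has_integral A) {0..1}"
    and hB: "((\<lambda>x. b x * b x) has_integral B) {0..1}"
    and hC: "((\<lambda>x. a x * b x) has_integral C) {0..1}"
    unfolding A_def B_def C_def
    by (intro integrable_integral integrable_continuous_real continuous_intros a b)+
  have B0: "B \<ge> 0" by (rule has_integral_nonneg[OF hB]) auto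
  have q: "A - 2 * t * C + t\<^sup>2 * B \<ge> 0" for t
  proof -
    have "((\<lambda>x. a x * a x - 2 * t * (a x * b x) + t\<^sup>2 * (b x * b x))
             has_integral (A - 2 * t * C + t\<^sup>2 * B)) {0..1}"
      by (intro has_integral_add has_integral_diff has_integral_mult_right hA hB hC)
    moreover have "a x * a x - 2 * t * (a x * b x) + t\<^sup>2 * (b x * b x) = (a x - t * b x)\<^sup>2" for x
      by (simp add: power2_eq_square algebra_simps)
    ultimately show ?thesis
      by (auto intro: has_integral_nonneg)
  qed
  have "C\<^sup>2 \<le> A * B"
  proof (cases "B = 0")
    case True
    have "C = 0"
    proof (rule ccontr)
      assume "C \<noteq> 0"
      then show False using q[of "(A + 1) / (2 * C)"] True by simp
    qed
    then show ?thesis using True by simp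
  next
    case False
    then have "B > 0" using B0 by simp
    moreover have "A - C\<^sup>2 / B \<ge> 0"
      using q[of "C / B"] False by (simp add: power2_eq_square field_simps)
    ultimately show ?thesis by (simp add: field_simps)
  qed
  then have "sqrt (C\<^sup>2) \<le> sqrt (A * B)" by (rule real_sqrt_le_mono)
  then show ?thesis by (simp add: real_sqrt_mult A_def B_def C_def)
qed

lemma test_functions_iterated_deriv_continuous:
  assumes "\<phi> \<in> test_functions"
  shows "continuous_on S ((deriv ^^ k) \<phi>)"
proof -
  have "(deriv ^^ k) \<phi> differentiable_on UNIV"
    using assms unfolding test_functions_def by simp
  then show ?thesis
    using continuous_on_subset[OF differentiable_imp_continuous_on subset_UNIV] by simp
qed

lemma test_functions_has_deriv:
  assumes "\<phi> \<in> test_functions"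
  shows "((deriv ^^ k) \<phi> has_real_derivative deriv ((deriv ^^ k) \<phi>) x) (at x)"
proof -
  have "(deriv ^^ k) \<phi> differentiable at x"
    using assms unfolding test_functions_def differentiable_on_def by auto
  then show ?thesis
    by (simp add: DERIV_deriv_iff_real_differentiable)
qed

lemma test_functions_continuous_deriv:
  assumes "\<phi> \<in> test_functions"
  shows "continuous_on S (deriv \<phi>)"
  using test_functions_iterated_deriv_continuous[OF assms, of S 1] by simp

lemma deriv_test_diff:
  assumes "\<phi> \<in> test_functions" "\<psi> \<in> test_functions"
  shows "deriv (\<lambda>x. \<phi> x - \<psi> x) = (\<lambda>x. deriv \<phi> x - deriv \<psi> x)"
  using test_functions_has_deriv[OF assms(1), of 0] test_functions_has_deriv[OF assms(2), of 0]
  by (intro ext DERIV_imp_deriv DERIV_diff) simp_all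

lemma iterated_deriv_test_diff:
  assumes "\<phi> \<in> test_functions" "\<psi> \<in> test_functions"
  shows "(deriv ^^ k) (\<lambda>x. \<phi> x - \<psi> x) = (\<lambda>x. (deriv ^^ k) \<phi> x - (deriv ^^ k) \<psi> x)"
proof (induction k)
  case (Suc k)
  have "deriv (\<lambda>x. (deriv ^^ k) \<phi> x - (deriv ^^ k) \<psi> x)
      = (\<lambda>x. deriv ((deriv ^^ k) \<phi>) x - deriv ((deriv ^^ k) \<psi>) x)"
    by (intro ext DERIV_imp_deriv DERIV_diff test_functions_has_deriv assms)
  then show ?case by (simp add: Suc)
qed simp

lemma test_functions_diff:
  assumes "\<phi> \<in> test_functions" "\<psi> \<in> test_functions"
  shows "(\<lambda>x. \<phi> x - \<psi> x) \<in> test_functions"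
proof -
  have "{x. \<phi> x - \<psi> x \<noteq> 0} \<subseteq> {x. \<phi> x \<noteq> 0} \<union> {x. \<psi> x \<noteq> 0}" by auto
  then have "closure {x. \<phi> x - \<psi> x \<noteq> 0} \<subseteq> closure {x. \<phi> x \<noteq> 0} \<union> closure {x. \<psi> x \<noteq> 0}"
    using closure_mono[of "{x. \<phi> x - \<psi> x \<noteq> 0}" "{x. \<phi> x \<noteq> 0} \<union> {x. \<psi> x \<noteq> 0}"]
    by (simp only: closure_Un)
  then show ?thesis
    using assms unfolding test_functions_def iterated_deriv_test_diff[OF assms] mem_Collect_eq
    by (blast intro: differentiable_on_diff)
qed

lemma test_functions_outside:
  assumes "\<phi> \<in> test_functions" "x \<notin> {0<..<1}"
  shows "\<phi> x = 0"
  using assms closure_subset[of "{x. \<phi> x \<noteq> 0}"] unfolding test_functions_def by blast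

lemma h10_prenorm_triangle:
  assumes "\<phi> \<in> test_functions" "\<psi> \<in> test_functions"
  shows "\<bar>h10_prenorm \<phi> - h10_prenorm \<psi>\<bar> \<le> h10_prenorm (\<lambda>x. \<phi> x - \<psi> x)"
    and "h10_prenorm (\<lambda>x. \<phi> x - \<psi> x) \<le> h10_prenorm \<phi> + h10_prenorm \<psi>"
proof -
  note [continuous_intros] = test_functions_continuous_deriv[OF assms(1)]
    test_functions_continuous_deriv[OF assms(2)]
  define A B C where "A = integral {0..1} (\<lambda>x. deriv \<phi> x * deriv \<phi> x)"
    and "B = integral {0..1} (\<lambda>x. deriv \<psi> x * deriv \<psi> x)"
    and "C = integral {0..1} (\<lambda>x. deriv \<phi> x * deriv \<psi> x)"
  have hA: "((\<lambda>x. deriv \<phi> x * deriv \<phi> x) has_integral A) {0..1}"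
    and hB: "((\<lambda>x. deriv \<psi> x * deriv \<psi> x) has_integral B) {0..1}"
    and hC: "((\<lambda>x. deriv \<phi> x * deriv \<psi> x) has_integral C) {0..1}"
    unfolding A_def B_def C_def
    by (intro integrable_integral integrable_continuous_real continuous_intros)+
  have pos: "A \<ge> 0" "B \<ge> 0" by (rule has_integral_nonneg[OF hA] has_integral_nonneg[OF hB]; simp)+
  have CS: "\<bar>C\<bar> \<le> sqrt A * sqrt B"
    unfolding A_def B_def C_def by (intro integral_Cauchy_Schwarz continuous_intros)
  have "((\<lambda>x. deriv \<phi> x * deriv \<phi> x - 2 * (deriv \<phi> x * deriv \<psi> x) + deriv \<psi> x * deriv \<psi> x)
          has_integral (A - 2 * C + B)) {0..1}"
    by (intro has_integral_add has_integral_diff has_integral_mult_right hA hB hC)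
  moreover have "(\<lambda>x. deriv \<phi> x * deriv \<phi> x - 2 * (deriv \<phi> x * deriv \<psi> x) + deriv \<psi> x * deriv \<psi> x)
      = (\<lambda>x. deriv (\<lambda>x. \<phi> x - \<psi> x) x * deriv (\<lambda>x. \<phi> x - \<psi> x) x)"
    by (simp add: deriv_test_diff[OF assms] algebra_simps)
  ultimately have D: "h10_prenorm (\<lambda>x. \<phi> x - \<psi> x) = sqrt (A - 2 * C + B)"
    unfolding h10_prenorm_def h10_inner_def by (metis integral_unique)
  have nA: "h10_prenorm \<phi> = sqrt A" and nB: "h10_prenorm \<psi> = sqrt B"
    unfolding h10_prenorm_def h10_inner_def A_def B_def by simp_all
  have s: "(sqrt A)\<^sup>2 = A" "(sqrt B)\<^sup>2 = B" using pos by simp_all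
  have "(sqrt A - sqrt B)\<^sup>2 \<le> A - 2 * C + B"
    using CS s by (simp add: power2_diff)
  then show "\<bar>h10_prenorm \<phi> - h10_prenorm \<psi>\<bar> \<le> h10_prenorm (\<lambda>x. \<phi> x - \<psi> x)"
    unfolding D nA nB by (metis real_sqrt_abs real_sqrt_le_mono)
  have "A - 2 * C + B \<le> (sqrt A + sqrt B)\<^sup>2"
    using CS s by (simp add: power2_sum)
  then show "h10_prenorm (\<lambda>x. \<phi> x - \<psi> x) \<le> h10_prenorm \<phi> + h10_prenorm \<psi>"
    unfolding D nA nB using pos by (metis real_le_lsqrt add_nonneg_nonneg real_sqrt_ge_zero)
qed

lemma h10_inner_tendsto_0:
  assumes \<phi>: "\<phi> \<in> test_functions" and d: "\<And>n. d n \<in> test_functions"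
    and lim: "uniform_limit {0..1} d (\<lambda>_. 0) sequentially"
  shows "(\<lambda>m. h10_inner \<phi> (d m)) \<longlonglongrightarrow> 0"
proof -
  let ?D = "deriv (deriv \<phi>)"
  have c: "continuous_on S ?D" for S
    using test_functions_iterated_deriv_continuous[OF \<phi>, of S 2] by (simp add: numeral_2_eq_2)
  have dc: "continuous_on S (d m)" for S m
    using test_functions_iterated_deriv_continuous[OF d, of S 0] by simp
  have eq: "h10_inner \<phi> (d m) = - integral {0..1} (\<lambda>x. ?D x * d m x)" for m
  proof -
    have "((\<lambda>x. deriv \<phi> x * deriv (d m) x) has_integral (- integral {0..1} (\<lambda>x. ?D x * d m x))) {0..1}"
    proof (rule integration_by_parts[OF bounded_bilinear.flip[OF bounded_bilinear_mult],
          of 0 1 "d m" "deriv \<phi>" "deriv (d m)" ?D])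
      show "continuous_on {0..1} (d m)" by (rule dc)
      show "continuous_on {0..1} (deriv \<phi>)" by (rule test_functions_continuous_deriv[OF \<phi>])
      show "(d m has_vector_derivative deriv (d m) x) (at x)" for x
        using test_functions_has_deriv[OF d, of 0]
        by (simp add: has_real_derivative_iff_has_vector_derivative)
      show "(deriv \<phi> has_vector_derivative ?D x) (at x)" for x
        using test_functions_has_deriv[OF \<phi>, of 1]
        by (simp add: has_real_derivative_iff_has_vector_derivative)
      have "((\<lambda>x. ?D x * d m x) has_integral integral {0..1} (\<lambda>x. ?D x * d m x)) {0..1}"
        by (intro integrable_integral integrable_continuous_real continuous_intros c dc)
      then show "((\<lambda>x. ?D x * d m x) has_integral
          (deriv \<phi> 1 * d m 1 - deriv \<phi> 0 * d m 0 - - integral {0..1} (\<lambda>x. ?D x * d m x))) {0..1}"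
        using test_functions_outside[OF d] by simp
    qed simp
    then show ?thesis unfolding h10_inner_def by (rule integral_unique)
  qed
  have "bounded (?D ` {0..1})"
    by (intro compact_imp_bounded compact_continuous_image c) simp
  moreover have "bounded ((\<lambda>_. 0::real) ` {0..1::real})"
    by (rule bounded_subset[of "{0}"]) auto
  ultimately have ul: "uniform_limit {0..1} (\<lambda>m x. ?D x * d m x) (\<lambda>x. ?D x * 0) sequentially"
    by (intro uniform_lim_mult uniform_limit_const lim)
  have cm: "continuous_on {0..1} (\<lambda>x. ?D x * d m x)" for m
    by (intro continuous_on_mult c dc)
  obtain I J where IJ: "\<And>m. ((\<lambda>x. ?D x * d m x) has_integral I m) {0..1}"
    "((\<lambda>x. ?D x * 0) has_integral J) {0..1}" "I \<longlonglongrightarrow> J"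
    using uniform_limit_integral[OF ul cm trivial_limit_sequentially] by blast
  have "J = 0" using integral_unique[OF IJ(2)] by simp
  moreover have "I = (\<lambda>m. integral {0..1} (\<lambda>x. ?D x * d m x))"
    by (rule ext) (rule integral_unique[OF IJ(1), symmetric])
  ultimately have "(\<lambda>m. integral {0..1} (\<lambda>x. ?D x * d m x)) \<longlonglongrightarrow> 0"
    using IJ(3) by simp
  then show ?thesis unfolding eq using tendsto_minus[of _ 0] by simp
qed

lemma h10_inner_diff_right:
  assumes "\<phi> \<in> test_functions" "\<psi> \<in> test_functions" "\<eta> \<in> test_functions"
  shows "h10_inner \<phi> (\<lambda>x. \<psi> x - \<eta> x) = h10_inner \<phi> \<psi> - h10_inner \<phi> \<eta>"
proof -
  note c = test_functions_continuous_deriv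
  have "(\<lambda>x. deriv \<phi> x * deriv \<psi> x) integrable_on {0..1}"
    "(\<lambda>x. deriv \<phi> x * deriv \<eta> x) integrable_on {0..1}"
    by (rule integrable_continuous_real[OF continuous_on_mult[OF c[OF assms(1)] c[OF assms(2)]]]
        integrable_continuous_real[OF continuous_on_mult[OF c[OF assms(1)] c[OF assms(3)]]])+
  then show ?thesis
    unfolding h10_inner_def deriv_test_diff[OF assms(2,3)] right_diff_distrib
    by (rule integral_diff)
qed

lemma h10_inner_le:
  assumes "\<phi> \<in> test_functions" "\<psi> \<in> test_functions"
  shows "\<bar>h10_inner \<phi> \<psi>\<bar> \<le> h10_prenorm \<phi> * h10_prenorm \<psi>"
  unfolding h10_inner_def h10_prenorm_def
  by (intro integral_Cauchy_Schwarz test_functions_continuous_deriv assms)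

lemma h10_prenorm_nonneg: "h10_prenorm \<phi> \<ge> 0"
  unfolding h10_prenorm_def h10_inner_def
  by (cases "(\<lambda>x. deriv \<phi> x * deriv \<phi> x) integrable_on {0..1}")
    (auto intro: integral_nonneg simp: not_integrable_integral)

lemma h10_prenorm_squared: "h10_inner \<phi> \<phi> = (h10_prenorm \<phi>)\<^sup>2"
  using h10_prenorm_nonneg[of \<phi>] unfolding h10_prenorm_def by simp

lemma h10_prenorm_tendsto_0:
  assumes d: "\<And>n. d n \<in> test_functions" and C: "h10_Cauchy d"
    and lim: "uniform_limit {0..1} d (\<lambda>_. 0) sequentially"
  shows "(\<lambda>n. h10_prenorm (d n)) \<longlonglongrightarrow> 0"
proof (rule LIMSEQ_I)
  fix e :: real assume "e > 0"
  then obtain N where N: "\<And>m n. m \<ge> N \<Longrightarrow> n \<ge> N \<Longrightarrow> h10_prenorm (\<lambda>x. d m x - d n x) < e / 2"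
    using C unfolding h10_Cauchy_def by (meson half_gt_zero)
  have "norm (h10_prenorm (d n) - 0) < e" if n: "n \<ge> N" for n
  proof -
    let ?a = "h10_prenorm (d n)"
    have "?a\<^sup>2 \<le> ?a * (e / 2) + h10_inner (d n) (d m)" if "m \<ge> N" for m
    proof -
      have "h10_inner (d n) (\<lambda>x. d n x - d m x) \<le> ?a * (e / 2)"
        using h10_inner_le[OF d test_functions_diff[OF d d], of n n m] N[OF n that]
          mult_left_mono[of "h10_prenorm (\<lambda>x. d n x - d m x)" "e / 2" ?a] h10_prenorm_nonneg[of "d n"]
        by linarith
      then show ?thesis
        unfolding h10_inner_diff_right[OF d d d] h10_prenorm_squared by simp
    qed
    then have "\<forall>\<^sub>F m in sequentially. ?a\<^sup>2 \<le> ?a * (e / 2) + h10_inner (d n) (d m)"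
      by (auto simp: eventually_sequentially)
    moreover have "(\<lambda>m. ?a * (e / 2) + h10_inner (d n) (d m)) \<longlonglongrightarrow> ?a * (e / 2) + 0"
      by (intro tendsto_intros h10_inner_tendsto_0 d lim)
    ultimately have "?a\<^sup>2 \<le> ?a * (e / 2) + 0"
      by (intro tendsto_lowerbound[of _ "?a * (e / 2) + 0" sequentially "?a\<^sup>2"]) auto
    then have "?a \<le> e / 2"
      using \<open>e > 0\<close> h10_prenorm_nonneg[of "d n"]
      by (cases "?a = 0") (auto simp: power2_eq_square)
    then show ?thesis using \<open>e > 0\<close> h10_prenorm_nonneg[of "d n"] by simp
  qed
  then show "\<exists>N. \<forall>n\<ge>N. norm (h10_prenorm (d n) - 0) < e" by blast
qed

lemma h10_represents_convergent:
  assumes "h10_represents \<phi> f"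
  shows "convergent (\<lambda>n. h10_prenorm (\<phi> n))"
proof (rule Cauchy_convergent, rule metric_CauchyI)
  fix e :: real assume "e > 0"
  then obtain N where "\<forall>m\<ge>N. \<forall>n\<ge>N. h10_prenorm (\<lambda>x. \<phi> m x - \<phi> n x) < e"
    using assms unfolding h10_represents_def h10_Cauchy_def by blast
  then show "\<exists>M. \<forall>m\<ge>M. \<forall>n\<ge>M. dist (h10_prenorm (\<phi> m)) (h10_prenorm (\<phi> n)) < e"
    using order_le_less_trans[OF h10_prenorm_triangle(1)] assms
    unfolding h10_represents_def dist_real_def by blast
qed

lemma h10_represents_unique:
  assumes \<phi>: "h10_represents \<phi> f" "(\<lambda>n. h10_prenorm (\<phi> n)) \<longlonglongrightarrow> L"
    and \<psi>: "h10_represents \<psi> f" "(\<lambda>n. h10_prenorm (\<psi> n)) \<longlonglongrightarrow> K"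
  shows "L = K"
proof -
  have t: "\<phi> n \<in> test_functions" "\<psi> n \<in> test_functions" for n
    using \<phi>(1) \<psi>(1) unfolding h10_represents_def by auto
  have ul: "uniform_limit {0..1} \<phi> f sequentially" "uniform_limit {0..1} \<psi> f sequentially"
    and Cauchy: "h10_Cauchy \<phi>" "h10_Cauchy \<psi>"
    using \<phi>(1) \<psi>(1) unfolding h10_represents_def by auto
  define d where "d = (\<lambda>n x. \<phi> n x - \<psi> n x)"
  have d: "d n \<in> test_functions" for n
    unfolding d_def by (intro test_functions_diff t)
  have C: "h10_Cauchy d"
    unfolding h10_Cauchy_def
  proof (intro allI impI)
    fix e :: real assume "e > 0"
    then have e2: "e / 2 > 0" by simp
    obtain M where M: "\<And>m n. m \<ge> M \<Longrightarrow> n \<ge> M \<Longrightarrow> h10_prenorm (\<lambda>x. \<phi> m x - \<phi> n x) < e / 2"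
      using Cauchy(1)[unfolded h10_Cauchy_def, rule_format, OF e2] by blast
    obtain N where N: "\<And>m n. m \<ge> N \<Longrightarrow> n \<ge> N \<Longrightarrow> h10_prenorm (\<lambda>x. \<psi> m x - \<psi> n x) < e / 2"
      using Cauchy(2)[unfolded h10_Cauchy_def, rule_format, OF e2] by blast
    have "h10_prenorm (\<lambda>x. d m x - d n x) < e" if "m \<ge> max M N" "n \<ge> max M N" for m n
    proof -
      have eq: "(\<lambda>x. d m x - d n x) = (\<lambda>x. (\<phi> m x - \<phi> n x) - (\<psi> m x - \<psi> n x))"
        by (auto simp: d_def)
      have "m \<ge> M" "n \<ge> M" "m \<ge> N" "n \<ge> N" using that by simp_all
      then show ?thesis
        unfolding eq
        using h10_prenorm_triangle(2)[OF test_functions_diff[OF t(1) t(1)]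
            test_functions_diff[OF t(2) t(2)], of m n m n] M[of m n] N[of m n]
        by linarith
    qed
    then show "\<exists>N. \<forall>m\<ge>N. \<forall>n\<ge>N. h10_prenorm (\<lambda>x. d m x - d n x) < e" by blast
  qed
  have "uniform_limit {0..1} d (\<lambda>x. f x - f x) sequentially"
    unfolding d_def by (rule uniform_limit_minus[OF ul])
  then have d0: "(\<lambda>n. h10_prenorm (d n)) \<longlonglongrightarrow> 0"
    using h10_prenorm_tendsto_0[OF d C] by simp
  have "norm (h10_prenorm (\<phi> n) - h10_prenorm (\<psi> n)) \<le> h10_prenorm (d n)" for n
    unfolding d_def real_norm_def by (rule h10_prenorm_triangle(1)[OF t])
  then have "(\<lambda>n. h10_prenorm (\<phi> n) - h10_prenorm (\<psi> n)) \<longlonglongrightarrow> 0"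
    by (rule Lim_null_comparison[OF always_eventually[OF allI] d0])
  moreover have "(\<lambda>n. h10_prenorm (\<phi> n) - h10_prenorm (\<psi> n)) \<longlonglongrightarrow> L - K"
    by (intro tendsto_diff \<phi>(2) \<psi>(2))
  ultimately have "L - K = 0" by (metis LIMSEQ_unique)
  then show ?thesis by simp
qed

lemma h10_norm_eq:
  assumes "h10_represents \<phi> f" "(\<lambda>n. h10_prenorm (\<phi> n)) \<longlonglongrightarrow> L"
  shows "h10_norm f = ennreal L"
proof -
  have "(THE L. \<exists>\<phi>. h10_represents \<phi> f \<and> (\<lambda>n. h10_prenorm (\<phi> n)) \<longlonglongrightarrow> L) = L"
  proof (rule the_equality)
    show "\<exists>\<phi>. h10_represents \<phi> f \<and> (\<lambda>n. h10_prenorm (\<phi> n)) \<longlonglongrightarrow> L"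
      using assms by blast
  next
    fix K assume "\<exists>\<phi>. h10_represents \<phi> f \<and> (\<lambda>n. h10_prenorm (\<phi> n)) \<longlonglongrightarrow> K"
    then show "K = L" using h10_represents_unique[OF _ _ assms] by blast
  qed
  moreover have "\<exists>\<phi>. h10_represents \<phi> f" using assms(1) by blast
  ultimately show ?thesis unfolding h10_norm_def by simp
qed


section \<open>Maximal correlation\<close>

definition covariance :: "'a measure \<Rightarrow> ('a \<Rightarrow> real) \<Rightarrow> ('a \<Rightarrow> real) \<Rightarrow> real" where
  "covariance M f g =
     (\<integral>x. (f x - (\<integral>y. f y \<partial>M)) * (g x - (\<integral>y. g y \<partial>M)) \<partial>M)"

definition std_dev :: "'a measure \<Rightarrow> ('a \<Rightarrow> real) \<Rightarrow> real" where
  "std_dev M f = sqrt (covariance M f f)"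

text \<open>A sub-\<open>\<sigma>\<close>-algebra is given by a measure \<open>F\<close>, of which only \<open>space\<close> and \<open>sets\<close> are used.\<close>

definition nonconst_L2 :: "'a measure \<Rightarrow> 'a measure \<Rightarrow> ('a \<Rightarrow> real) set" where
  "nonconst_L2 M F =
     {f \<in> borel_measurable F. integrable M (\<lambda>x. (f x)\<^sup>2) \<and> \<not> (\<exists>c. AE x in M. f x = c)}"

text \<open>
  If \<open>F\<close> or \<open>G\<close> is trivial, the supremum is over the empty set, hence \<open>0\<close> in \<^typ>\<open>ennreal\<close>.
\<close>

definition max_correlation :: "'a measure \<Rightarrow> 'a measure \<Rightarrow> 'a measure \<Rightarrow> ennreal" where
  "max_correlation M F G =
     (SUP (f, g) \<in> nonconst_L2 M F \<times> nonconst_L2 M G.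
        ennreal (\<bar>covariance M f g\<bar> / (std_dev M f * std_dev M g)))"

end

theory Submission
  imports Defs
begin

text \<open>
  For step functions \<open>f = a + (\<Sum>i. c i * 1\<^bsub>A i\<^esub>)\<close> and \<open>g = b + (\<Sum>j. d j * 1\<^bsub>B j\<^esub>)\<close> over nested
  level sets with \<open>c, d \<ge> 0\<close>, the hypothesis, summed over the levels (Hoeffding's covariance formula),
  bounds \<open>Cov(f, g)\<close> by \<open>(\<Sum>i. c i * \<zeta> (Pr (A i))) * (\<Sum>j. d j * \<theta> (Pr (B j)))\<close>. Writing
  \<open>\<zeta>(p) = \<integral> 1\<^bsub>[0,p]\<^esub> \<zeta>'\<close> and using that \<open>\<zeta>'\<close> has mean \<open>0\<close>, the first factor is the scalar product of
  \<open>\<zeta>'\<close> with the centred function \<open>\<Sum>i. c i * (1\<^bsub>[0,Pr (A i)]\<^esub> - Pr (A i))\<close>, whose \<open>L\<^sup>2\<close> norm is \<open>sd(f)\<close>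
  because the \<open>A i\<close> are nested; Cauchy-Schwarz concludes. General \<open>f\<close> and \<open>g\<close> follow by quantisation,
  and the absolute value by replacing \<open>f\<close> with \<open>-f\<close>.
\<close>

section \<open>Layer sums bounded by the Sobolev norm\<close>

text \<open>
  For \<open>c \<ge> 0\<close>, the double sum is the variance of a step function with jumps \<open>c i\<close> over nested events
  of probabilities \<open>p i\<close>.
\<close>

definition layer_bound :: "(real \<Rightarrow> real) \<Rightarrow> real \<Rightarrow> bool" where
  "layer_bound \<zeta> L \<longleftrightarrow>
     (\<forall>(I :: nat set) c p. finite I \<longrightarrow> (\<forall>i\<in>I. p i \<in> {0..1}) \<longrightarrow>
        \<bar>\<Sum>i\<in>I. c i * \<zeta> (p i)\<bar>
          \<le> L * sqrt (\<Sum>i\<in>I. \<Sum>j\<in>I. c i * c j * (min (p i) (p j) - p i * p j)))"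

lemma layer_bound_zero: "layer_bound (\<lambda>_. 0) 0"
  by (simp add: layer_bound_def)

lemma has_integral_of_bool_le:
  fixes f :: "real \<Rightarrow> real"
  assumes "(f has_integral y) {0..p}" "p \<in> {0..1}"
  shows "((\<lambda>v. of_bool (v \<le> p) * f v) has_integral y) {0..1}"
proof -
  have "((\<lambda>v. if v \<in> {0..p} then f v else 0) has_integral y) {0..1}"
    using assms by (subst has_integral_restrict) auto
  then show ?thesis
    by (rule has_integral_eq[rotated]) auto
qed

text \<open>Cauchy-Schwarz in discriminant form. It is applied to a step function \<open>h\<close>,
  which is discontinuous and so outside the reach of \<open>integral_Cauchy_Schwarz\<close>.\<close>

lemma discriminant_le:
  fixes A S V :: real
  assumes q: "\<And>t. V - 2 * t * S + t\<^sup>2 * A \<ge> 0" and A0: "A \<ge> 0" and V0: "V \<ge> 0"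
  shows "\<bar>S\<bar> \<le> sqrt A * sqrt V"
proof -
  have "S\<^sup>2 \<le> A * V"
  proof (cases "A = 0")
    case True
    have "S = 0"
    proof (rule ccontr)
      assume "S \<noteq> 0"
      \<comment> \<open>For \<open>A = 0\<close> the quadratic is affine in \<open>t\<close>, and
        this \<open>t\<close> gives it the value -1.\<close>
      then show False using q[of "(V + 1) / (2 * S)"] True by simp
    qed
    then show ?thesis using True by simp
  next
    case False
    then have "A > 0" using A0 by simp
    \<comment> \<open>\<open>t = S / A\<close> minimises the quadratic.\<close>
    moreover have "V - S\<^sup>2 / A \<ge> 0"
      using q[of "S / A"] False by (simp add: power2_eq_square field_simps)
    ultimately show ?thesis by (simp add: field_simps)
  qed
  then have "sqrt (S\<^sup>2) \<le> sqrt (A * V)" by (rule real_sqrt_le_mono)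
  then show ?thesis by (simp add: real_sqrt_mult)
qed

text \<open>
  Both sides are integrals over \<open>{0..1}\<close>: with \<open>h = (\<Sum>i\<in>I. c i * (of_bool (v \<le> p i) - p i))\<close>, the sum on
  the left is \<open>\<integral> h \<phi>'\<close> and the sum under the root is \<open>\<integral> h\<^sup>2\<close>.
\<close>

lemma layer_bound_test_function:
  assumes \<phi>: "\<phi> \<in> test_functions"
  shows "layer_bound \<phi> (h10_prenorm \<phi>)"
  unfolding layer_bound_def
proof (intro allI impI)
  fix I :: "nat set" and c p :: "nat \<Rightarrow> real"
  assume fin: "finite I" and "\<forall>i\<in>I. p i \<in> {0..1}"
  then have p: "p i \<in> {0..1}" if "i \<in> I" for i using that by blast
  define e where "e i v = of_bool (v \<le> p i) - p i" for i v
  define h where "h v = (\<Sum>i\<in>I. c i * e i v)" for v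
  define V where "V = (\<Sum>i\<in>I. \<Sum>j\<in>I. c i * c j * (min (p i) (p j) - p i * p j))"
  define S where "S = (\<Sum>i\<in>I. c i * \<phi> (p i))"
  define A where "A = h10_inner \<phi> \<phi>"
  have ftc: "(deriv \<phi> has_integral \<phi> x) {0..x}" if "x \<in> {0..1}" for x
  proof -
    have "(deriv \<phi> has_integral \<phi> x - \<phi> 0) {0..x}"
      using that test_functions_has_deriv[OF \<phi>, of 0]
      by (intro fundamental_theorem_of_calculus)
        (auto simp flip: has_real_derivative_iff_has_vector_derivative
          intro: has_field_derivative_at_within)
    then show ?thesis using test_functions_outside[OF \<phi>, of 0] by simp
  qed
  have one: "((\<lambda>v. of_bool (v \<le> x)) has_integral x) {0..1}" if "x \<in> {0..1}" for x :: real
    using has_integral_of_bool_le[of "\<lambda>_. 1" x x] has_integral_const_real[of "1::real" 0 x] that by simp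
  have c1: "((\<lambda>v :: real. a) has_integral a) {0..1}" for a :: real
    using has_integral_const_real[of a 0 1] by simp
  \<comment> \<open>\<open>e i\<close> is the centred indicator of \<open>[0, p i]\<close>; the
    product of two such indicators is the indicator up to \<open>min (p i) (p j)\<close>.\<close>
  have ee: "((\<lambda>v. e i v * e j v) has_integral (min (p i) (p j) - p i * p j)) {0..1}"
    if "i \<in> I" "j \<in> I" for i j
  proof -
    have "((\<lambda>v. of_bool (v \<le> min (p i) (p j)) - p j * of_bool (v \<le> p i)
              - p i * of_bool (v \<le> p j) + p i * p j)
            has_integral (min (p i) (p j) - p j * p i - p i * p j + p i * p j)) {0..1}"
      using p[OF that(1)] p[OF that(2)]
      by (intro has_integral_add has_integral_diff has_integral_mult_right one c1) auto
    then show ?thesis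
      by (rule has_integral_eq_rhs[OF has_integral_eq[rotated]])
        (auto simp: e_def algebra_simps)
  qed
  \<comment> \<open>The centring term contributes \<open>p i * \<phi> 1\<close>, which is 0: this is
    where \<open>deriv \<phi>\<close> having mean 0 enters.\<close>
  have ed: "((\<lambda>v. e i v * deriv \<phi> v) has_integral \<phi> (p i)) {0..1}" if "i \<in> I" for i
  proof -
    have "((\<lambda>v. of_bool (v \<le> p i) * deriv \<phi> v - p i * deriv \<phi> v)
            has_integral (\<phi> (p i) - p i * \<phi> 1)) {0..1}"
      using p[OF that]
      by (intro has_integral_diff has_integral_mult_right has_integral_of_bool_le ftc) auto
    then show ?thesis
      using test_functions_outside[OF \<phi>, of 1] by (simp add: e_def algebra_simps)
  qed
  have hV: "((\<lambda>v. h v * h v) has_integral V) {0..1}"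
  proof -
    have "((\<lambda>v. \<Sum>i\<in>I. \<Sum>j\<in>I. c i * c j * (e i v * e j v)) has_integral V) {0..1}"
      unfolding V_def by (intro has_integral_sum fin has_integral_mult_right ee)
    then show ?thesis by (simp add: h_def sum_product mult_ac)
  qed
  have hS: "((\<lambda>v. h v * deriv \<phi> v) has_integral S) {0..1}"
  proof -
    have "((\<lambda>v. \<Sum>i\<in>I. c i * (e i v * deriv \<phi> v)) has_integral S) {0..1}"
      unfolding S_def by (intro has_integral_sum fin has_integral_mult_right ed)
    then show ?thesis by (simp add: h_def sum_distrib_left sum_distrib_right mult_ac)
  qed
  have hA: "((\<lambda>v. deriv \<phi> v * deriv \<phi> v) has_integral A) {0..1}"
    unfolding A_def h10_inner_def
    by (intro integrable_integral integrable_continuous_real continuous_intros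
        test_functions_continuous_deriv \<phi>)
  \<comment> \<open>The quadratic is the integral of the square of
    \<open>h - t * deriv \<phi>\<close>.\<close>
  have "V - 2 * t * S + t\<^sup>2 * A \<ge> 0" for t
  proof -
    have "((\<lambda>v. h v * h v - 2 * t * (h v * deriv \<phi> v) + t\<^sup>2 * (deriv \<phi> v * deriv \<phi> v))
             has_integral (V - 2 * t * S + t\<^sup>2 * A)) {0..1}"
      by (intro has_integral_add has_integral_diff has_integral_mult_right hA hS hV)
    moreover have "h v * h v - 2 * t * (h v * deriv \<phi> v) + t\<^sup>2 * (deriv \<phi> v * deriv \<phi> v)
        = (h v - t * deriv \<phi> v)\<^sup>2" for v
      by (simp add: power2_eq_square algebra_simps)
    ultimately show ?thesis by (auto intro: has_integral_nonneg)
  qed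
  moreover have "A \<ge> 0" "V \<ge> 0"
    by (rule has_integral_nonneg[OF hA] has_integral_nonneg[OF hV]; simp)+
  ultimately have "\<bar>S\<bar> \<le> sqrt A * sqrt V" by (rule discriminant_le)
  then show "\<bar>\<Sum>i\<in>I. c i * \<phi> (p i)\<bar> \<le> h10_prenorm \<phi> *
      sqrt (\<Sum>i\<in>I. \<Sum>j\<in>I. c i * c j * (min (p i) (p j) - p i * p j))"
    by (simp add: S_def A_def V_def h10_prenorm_def)
qed

text \<open>The inequality involves \<open>\<zeta>\<close> at finitely many points only, and the
  root does not depend on \<open>\<zeta>\<close>, so it survives the limit of the approximating test
  functions.\<close>

lemma layer_bound_limit:
  assumes "h10_represents \<phi> \<zeta>" "(\<lambda>n. h10_prenorm (\<phi> n)) \<longlonglongrightarrow> L"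
  shows "layer_bound \<zeta> L"
  unfolding layer_bound_def
proof (intro allI impI)
  fix I :: "nat set" and c p :: "nat \<Rightarrow> real"
  assume fin: "finite I" and p: "\<forall>i\<in>I. p i \<in> {0..1}"
  let ?V = "\<Sum>i\<in>I. \<Sum>j\<in>I. c i * c j * (min (p i) (p j) - p i * p j)"
  have t: "\<phi> n \<in> test_functions" and ul: "uniform_limit {0..1} \<phi> \<zeta> sequentially" for n
    using assms(1) unfolding h10_represents_def by auto
  have "(\<lambda>n. \<bar>\<Sum>i\<in>I. c i * \<phi> n (p i)\<bar>) \<longlonglongrightarrow> \<bar>\<Sum>i\<in>I. c i * \<zeta> (p i)\<bar>"
    using p by (intro tendsto_intros tendsto_uniform_limitI[OF ul]) auto
  moreover have "(\<lambda>n. h10_prenorm (\<phi> n) * sqrt ?V) \<longlonglongrightarrow> L * sqrt ?V"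
    by (intro tendsto_intros assms(2))
  moreover have "\<bar>\<Sum>i\<in>I. c i * \<phi> n (p i)\<bar> \<le> h10_prenorm (\<phi> n) * sqrt ?V" for n
    using layer_bound_test_function[OF t[of n]] fin p unfolding layer_bound_def by blast
  ultimately show "\<bar>\<Sum>i\<in>I. c i * \<zeta> (p i)\<bar> \<le> L * sqrt ?V"
    by (intro LIMSEQ_le) auto
qed

text \<open>A single layer of probability \<open>x\<close> with coefficient 1 suffices.\<close>

lemma layer_bound_0_imp_zero:
  assumes "layer_bound \<zeta> 0" "x \<in> {0..1}"
  shows "\<zeta> x = 0"
  using assms(1)[unfolded layer_bound_def, rule_format, of "{0}" "\<lambda>_. x" "\<lambda>_. 1"] assms(2) by simp

section \<open>Covariances of step functions\<close>

text \<open>Bilinearity, the constants \<open>a\<close> and \<open>b\<close> being removed by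
  centring. Taking both functions equal yields the variance.\<close>

lemma (in prob_space) covariance_step_functions:
  fixes c d :: "nat \<Rightarrow> real"
  assumes fin: "finite I" "finite J"
    and A: "\<And>i. i \<in> I \<Longrightarrow> A i \<in> events" and B: "\<And>j. j \<in> J \<Longrightarrow> B j \<in> events"
  shows "covariance M (\<lambda>x. (\<Sum>i\<in>I. c i * indicator (A i) x) + a)
                      (\<lambda>x. (\<Sum>j\<in>J. d j * indicator (B j) x) + b)
       = (\<Sum>i\<in>I. \<Sum>j\<in>J. c i * d j * (prob (A i \<inter> B j) - prob (A i) * prob (B j)))"
proof -
  have ind: "integrable M (indicator X :: 'a \<Rightarrow> real)" "expectation (indicator X) = prob X"
    if "X \<in> events" for X
    using that by (auto simp: integral_indicator Int_absorb1 sets.sets_into_space emeasure_eq_measure)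
  have mean: "expectation (\<lambda>x. (\<Sum>i\<in>K. e i * indicator (X i) x) + s) = (\<Sum>i\<in>K. e i * prob (X i)) + s"
    if "\<And>i. i \<in> K \<Longrightarrow> X i \<in> events" for K :: "nat set" and e X s
    using that by (subst Bochner_Integration.integral_add)
      (auto simp: prob_space ind intro!: sum.cong)
  have cell: "has_bochner_integral M
      (\<lambda>x. c i * d j * ((indicator (A i) x - prob (A i)) * (indicator (B j) x - prob (B j))))
      (c i * d j * (prob (A i \<inter> B j) - prob (A i) * prob (B j)))" if "i \<in> I" "j \<in> J" for i j
  proof -
    have E: "A i \<in> events" "B j \<in> events" "A i \<inter> B j \<in> events" using A B that by auto
    have "has_bochner_integral M (\<lambda>x. indicator (A i \<inter> B j) x - prob (B j) * indicator (A i) x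
          - prob (A i) * indicator (B j) x + prob (A i) * prob (B j))
        (prob (A i \<inter> B j) - prob (B j) * prob (A i) - prob (A i) * prob (B j) + prob (A i) * prob (B j))"
      using E by (auto simp: has_bochner_integral_iff ind prob_space)
    then have "has_bochner_integral M
        (\<lambda>x. (indicator (A i) x - prob (A i)) * (indicator (B j) x - prob (B j)))
        (prob (A i \<inter> B j) - prob (A i) * prob (B j))"
      by (simp add: indicator_inter_arith algebra_simps)
    then show ?thesis by (rule has_bochner_integral_mult_right)
  qed
  have "has_bochner_integral M (\<lambda>x. \<Sum>i\<in>I. \<Sum>j\<in>J.
        c i * d j * ((indicator (A i) x - prob (A i)) * (indicator (B j) x - prob (B j))))
      (\<Sum>i\<in>I. \<Sum>j\<in>J. c i * d j * (prob (A i \<inter> B j) - prob (A i) * prob (B j)))"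
    by (intro has_bochner_integral_sum cell)
  moreover have "(\<Sum>i\<in>I. \<Sum>j\<in>J.
        c i * d j * ((indicator (A i) x - prob (A i)) * (indicator (B j) x - prob (B j))))
     = (((\<Sum>i\<in>I. c i * indicator (A i) x) + a) - ((\<Sum>i\<in>I. c i * prob (A i)) + a)) *
       (((\<Sum>j\<in>J. d j * indicator (B j) x) + b) - ((\<Sum>j\<in>J. d j * prob (B j)) + b))" for x
    by (simp add: sum_subtractf[symmetric] right_diff_distrib[symmetric] sum_product mult_ac)
  ultimately show ?thesis
    unfolding covariance_def using mean[OF A] mean[OF B]
    by (simp add: has_bochner_integral_integral_eq)
qed

lemma (in prob_space) prob_Int_nested:
  assumes "X \<in> events" "Y \<in> events" "X \<subseteq> Y \<or> Y \<subseteq> X"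
  shows "prob (X \<inter> Y) = min (prob X) (prob Y)"
  using assms finite_measure_mono[of X Y] finite_measure_mono[of Y X]
  by (auto simp: Int_absorb1 Int_absorb2 min_def)

text \<open>Nestedness turns each variance into the double sum of \<open>layer_bound\<close>.
  Nonnegative coefficients allow \<open>dep\<close> to be summed over all pairs of levels, and the
  resulting double sum factorises.\<close>

lemma (in prob_space) covariance_nested_step_functions_le:
  fixes c d :: "nat \<Rightarrow> real" and a b :: real
  assumes L: "layer_bound \<zeta> L" and K: "layer_bound \<theta> K"
    and sub: "subalgebra M F" "subalgebra M G"
    and dep: "\<And>A B. A \<in> sets F \<Longrightarrow> B \<in> sets G \<Longrightarrow> prob (A \<inter> B) - prob A * prob B \<le> \<zeta> (prob A) * \<theta> (prob B)"
    and fin: "finite I" "finite J"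
    and A: "\<And>i. i \<in> I \<Longrightarrow> A i \<in> sets F" and B: "\<And>j. j \<in> J \<Longrightarrow> B j \<in> sets G"
    and cd: "\<And>i. i \<in> I \<Longrightarrow> c i \<ge> 0" "\<And>j. j \<in> J \<Longrightarrow> d j \<ge> 0"
    and nested: "\<And>i j. i \<in> I \<Longrightarrow> j \<in> I \<Longrightarrow> A i \<subseteq> A j \<or> A j \<subseteq> A i"
      "\<And>i j. i \<in> J \<Longrightarrow> j \<in> J \<Longrightarrow> B i \<subseteq> B j \<or> B j \<subseteq> B i"
  defines "f \<equiv> \<lambda>x. (\<Sum>i\<in>I. c i * indicator (A i) x) + a"
    and "g \<equiv> \<lambda>x. (\<Sum>j\<in>J. d j * indicator (B j) x) + b"
  shows "covariance M f g \<le> L * K * (std_dev M f * std_dev M g)"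
proof -
  have ev: "i \<in> I \<Longrightarrow> A i \<in> events" "j \<in> J \<Longrightarrow> B j \<in> events" for i j
    using A B sub unfolding subalgebra_def by auto
  have "covariance M f f = (\<Sum>i\<in>I. \<Sum>j\<in>I. c i * c j *
      (prob (A i \<inter> A j) - prob (A i) * prob (A j)))"
    unfolding f_def by (intro covariance_step_functions fin ev)
  also have "\<dots> = (\<Sum>i\<in>I. \<Sum>j\<in>I. c i * c j *
      (min (prob (A i)) (prob (A j)) - prob (A i) * prob (A j)))"
    by (intro sum.cong refl) (simp add: prob_Int_nested ev nested)
  finally have var_f: "covariance M f f = \<dots>" .
  have "covariance M g g = (\<Sum>i\<in>J. \<Sum>j\<in>J. d i * d j *
      (prob (B i \<inter> B j) - prob (B i) * prob (B j)))"
    unfolding g_def by (intro covariance_step_functions fin ev)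
  also have "\<dots> = (\<Sum>i\<in>J. \<Sum>j\<in>J. d i * d j *
      (min (prob (B i)) (prob (B j)) - prob (B i) * prob (B j)))"
    by (intro sum.cong refl) (simp add: prob_Int_nested ev nested)
  finally have var_g: "covariance M g g = \<dots>" .
  have bf: "\<bar>\<Sum>i\<in>I. c i * \<zeta> (prob (A i))\<bar> \<le> L * std_dev M f"
    using L[unfolded layer_bound_def, rule_format, of I "\<lambda>i. prob (A i)" c] fin
    by (simp add: std_dev_def var_f)
  have bg: "\<bar>\<Sum>j\<in>J. d j * \<theta> (prob (B j))\<bar> \<le> K * std_dev M g"
    using K[unfolded layer_bound_def, rule_format, of J "\<lambda>i. prob (B i)" d] fin
    by (simp add: std_dev_def var_g)
  have "covariance M f g =
      (\<Sum>i\<in>I. \<Sum>j\<in>J. c i * d j * (prob (A i \<inter> B j) - prob (A i) * prob (B j)))"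
    unfolding f_def g_def by (rule covariance_step_functions[OF fin ev])
  also have "\<dots> \<le> (\<Sum>i\<in>I. \<Sum>j\<in>J. c i * d j * (\<zeta> (prob (A i)) * \<theta> (prob (B j))))"
    by (intro sum_mono mult_left_mono dep A B mult_nonneg_nonneg cd)
  also have "\<dots> = (\<Sum>i\<in>I. c i * \<zeta> (prob (A i))) * (\<Sum>j\<in>J. d j * \<theta> (prob (B j)))"
    by (simp add: sum_product mult_ac)
  \<comment> \<open>Either sum may be negative, so absolute values are taken before the two bounds
    are multiplied.\<close>
  also have "\<dots> \<le> \<bar>\<Sum>i\<in>I. c i * \<zeta> (prob (A i))\<bar> * \<bar>\<Sum>j\<in>J. d j * \<theta> (prob (B j))\<bar>"
    unfolding abs_mult[symmetric] by (rule abs_ge_self)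
  also have "\<dots> \<le> (L * std_dev M f) * (K * std_dev M g)"
    by (intro mult_mono bf bg abs_ge_zero order_trans[OF abs_ge_zero bf])
  finally show ?thesis by (simp add: mult_ac)
qed

section \<open>Quantisation of real values\<close>

text \<open>Truncation to \<open>[-(n+1), n+1]\<close> and rounding down to multiples of
  \<open>1/(n+1)\<close>. The form as a sum of rays makes its composition with a function a step
  function with equal positive jumps over nested superlevel sets; the last threshold is
  \<open>n+1\<close>.\<close>

definition quantise :: "nat \<Rightarrow> real \<Rightarrow> real" where
  "quantise n x = (\<Sum>k\<in>{1..2 * (Suc n)\<^sup>2}.
     1 / Suc n * indicator {real k / Suc n - Suc n..} x) + - real (Suc n)"

text \<open>The sum counts the thresholds not exceeding \<open>x\<close>: those with index at most
  the floor, capped by their total number \<open>2 * (Suc n)\<^sup>2\<close>.\<close>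

lemma quantise_eq:
  "quantise n x = min (2 * real (Suc n)) (real (nat \<lfloor>(x + Suc n) * Suc n\<rfloor>) / Suc n) - Suc n"
proof -
  define N where "N = 2 * (Suc n)\<^sup>2"
  define m where "m = nat \<lfloor>(x + Suc n) * Suc n\<rfloor>"
  \<comment> \<open>Indices start at 1 because \<open>nat\<close> sends a negative floor to 0, which
    would break the equivalence at \<open>k = 0\<close>.\<close>
  have iff: "x \<in> {real k / Suc n - Suc n..} \<longleftrightarrow> k \<le> m" if "k \<ge> 1" for k
  proof -
    have "x \<in> {real k / Suc n - Suc n..} \<longleftrightarrow> real k \<le> (x + Suc n) * Suc n"
      by (simp add: field_simps del: of_nat_Suc)
    also have "\<dots> \<longleftrightarrow> int k \<le> \<lfloor>(x + Suc n) * Suc n\<rfloor>"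
      by (simp add: le_floor_iff del: of_nat_Suc)
    also have "\<dots> \<longleftrightarrow> k \<le> m"
      unfolding m_def using that by linarith
    finally show ?thesis .
  qed
  have "(\<Sum>k\<in>{1..N}. 1 / Suc n * indicator {real k / Suc n - Suc n..} x)
      = (\<Sum>k\<in>{1..N}. if k \<le> m then 1 / Suc n else 0)"
    using iff by (intro sum.cong) (auto simp: indicator_def)
  also have "\<dots> = (\<Sum>k\<in>{k \<in> {1..N}. k \<le> m}. 1 / Suc n)"
    by (simp only: sum.inter_filter finite_atLeastAtMost)
  also have "{k \<in> {1..N}. k \<le> m} = {1..min N m}" by auto
  also have "(\<Sum>k\<in>{1..min N m}. 1 / real (Suc n)) = real (min N m) / Suc n" by simp
  also have "\<dots> = min (2 * real (Suc n)) (real m / Suc n)"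
  proof -
    have "2 * real (Suc n) = real N / Suc n"
      unfolding N_def power2_eq_square of_nat_mult by (simp del: of_nat_Suc)
    then show ?thesis
      by (simp add: min_def divide_le_cancel del: of_nat_Suc)
  qed
  finally show ?thesis unfolding quantise_def N_def m_def by simp
qed

lemma quantise_close:
  fixes x :: real
  assumes "\<bar>x\<bar> \<le> Suc n"
  shows "\<bar>quantise n x - x\<bar> \<le> 1 / Suc n"
proof -
  define s where "s = real (Suc n)"
  define m where "m = nat \<lfloor>(x + s) * s\<rfloor>"
  have s: "s > 0" by (simp add: s_def)
  have x: "0 \<le> x + s" "x + s \<le> 2 * s" using assms by (auto simp: s_def)
  have "(x + s) * s \<ge> 0" using x s by simp
  then have m: "real m \<le> (x + s) * s" "(x + s) * s < real m + 1"
    unfolding m_def by linarith+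
  then have "real m / s \<le> x + s" "x + s < real m / s + 1 / s"
    using s by (auto simp: field_simps)
  moreover have "quantise n x = min (2 * s) (real m / s) - s"
    unfolding quantise_eq m_def s_def by simp
  ultimately show ?thesis using x unfolding s_def[symmetric] by linarith
qed

text \<open>A bound uniform in \<open>n\<close>, for dominated convergence. Within the truncation
  range the rounding error is at most 1; outside it the value stays within
  \<open>Suc n < \<bar>x\<bar>\<close>.\<close>

lemma quantise_abs_le: "\<bar>quantise n x\<bar> \<le> \<bar>x\<bar> + 1"
proof (cases "\<bar>x\<bar> \<le> Suc n")
  case True
  have "1 / real (Suc n) \<le> 1" by simp
  then show ?thesis using quantise_close[OF True] by linarith
next
  case False
  have "real (nat k) / Suc n \<ge> 0" for k by simp
  then have "\<bar>quantise n x\<bar> \<le> Suc n"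
    unfolding quantise_eq by (smt (verit) of_nat_0_le_iff)
  then show ?thesis using False by linarith
qed

lemma quantise_tendsto: "(\<lambda>n. quantise n x) \<longlonglongrightarrow> x"
proof (rule LIM_zero_cancel, rule Lim_null_comparison)
  show "(\<lambda>n. 1 / real (Suc n)) \<longlonglongrightarrow> 0"
    using LIMSEQ_inverse_real_of_nat by (simp add: inverse_eq_divide)
  obtain N where N: "\<bar>x\<bar> \<le> real N" using real_arch_simple by blast
  show "\<forall>\<^sub>F n in sequentially. norm (quantise n x - x) \<le> 1 / real (Suc n)"
    unfolding eventually_sequentially real_norm_def
    by (rule exI[of _ N]) (use N in \<open>auto intro!: quantise_close simp del: of_nat_Suc\<close>)
qed

lemma quantise_measurable [measurable]: "quantise n \<in> borel_measurable borel"
  unfolding quantise_def by measurable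

section \<open>Passage to square-integrable functions\<close>

lemma (in finite_measure) integrable_mult_of_squares:
  fixes f g :: "'a \<Rightarrow> real"
  assumes [measurable]: "f \<in> borel_measurable M" "g \<in> borel_measurable M"
    and "integrable M (\<lambda>x. (f x)\<^sup>2)" "integrable M (\<lambda>x. (g x)\<^sup>2)"
  shows "integrable M (\<lambda>x. f x * g x)"
proof (rule Bochner_Integration.integrable_bound)
  show "integrable M (\<lambda>x. (f x)\<^sup>2 + (g x)\<^sup>2)" using assms by simp
  have "\<bar>a * b\<bar> \<le> a\<^sup>2 + b\<^sup>2" for a b :: real
    using sum_squares_bound[of "\<bar>a\<bar>" "\<bar>b\<bar>"] abs_ge_zero[of "a * b"] unfolding abs_mult power2_abs by linarith
  then show "AE x in M. norm (f x * g x) \<le> norm ((f x)\<^sup>2 + (g x)\<^sup>2)" by simp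
qed simp

lemma (in prob_space) covariance_eq:
  assumes [simp]: "integrable M f" "integrable M g" "integrable M (\<lambda>x. f x * g x)"
  shows "covariance M f g = expectation (\<lambda>x. f x * g x) - expectation f * expectation g"
proof -
  have "covariance M f g = expectation (\<lambda>x. f x * g x - expectation g * f x
      - expectation f * g x + expectation f * expectation g)"
    unfolding covariance_def by (simp add: algebra_simps)
  also have "\<dots> = expectation (\<lambda>x. f x * g x) - expectation f * expectation g"
    by (simp add: prob_space)
  finally show ?thesis .
qed

text \<open>Dominated convergence for both means and for the mean of the product. The case of equal
  functions serves the standard deviations.\<close>

lemma (in prob_space) covariance_quantise_tendsto:
  assumes [measurable]: "f \<in> borel_measurable M" "g \<in> borel_measurable M"
    and sq: "integrable M (\<lambda>x. (f x)\<^sup>2)" "integrable M (\<lambda>x. (g x)\<^sup>2)"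
  shows "(\<lambda>n. covariance M (\<lambda>x. quantise n (f x)) (\<lambda>x. quantise n (g x))) \<longlonglongrightarrow> covariance M f g"
proof -
  have int [simp]: "integrable M f" "integrable M g" "integrable M (\<lambda>x. f x * g x)"
    by (rule square_integrable_imp_integrable integrable_mult_of_squares; fact assms)+
  have bf: "integrable M (\<lambda>x. \<bar>f x\<bar> + 1)" and bg: "integrable M (\<lambda>x. \<bar>g x\<bar> + 1)" by simp_all
  have "integrable M (\<lambda>x. \<bar>f x * g x\<bar> + \<bar>f x\<bar> + \<bar>g x\<bar> + 1)" by simp
  then have bfg: "integrable M (\<lambda>x. (\<bar>f x\<bar> + 1) * (\<bar>g x\<bar> + 1))"
    by (simp add: abs_mult algebra_simps)
  have le: "\<bar>quantise n a * quantise n b\<bar> \<le> (\<bar>a\<bar> + 1) * (\<bar>b\<bar> + 1)" for n a b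
    unfolding abs_mult by (intro mult_mono quantise_abs_le) auto
  have iq: "integrable M (\<lambda>x. quantise n (f x))" "integrable M (\<lambda>x. quantise n (g x))"
    "integrable M (\<lambda>x. quantise n (f x) * quantise n (g x))" for n
    by (rule Bochner_Integration.integrable_bound[OF bf] Bochner_Integration.integrable_bound[OF bg]
        Bochner_Integration.integrable_bound[OF bfg];
        use quantise_abs_le le in \<open>auto intro!: order_trans[OF _ abs_ge_self]\<close>)+
  have "(\<lambda>n. expectation (\<lambda>x. quantise n (f x))) \<longlonglongrightarrow> expectation f"
    by (rule integral_dominated_convergence[OF _ _ bf])
      (auto intro!: quantise_tendsto quantise_abs_le)
  moreover have "(\<lambda>n. expectation (\<lambda>x. quantise n (g x))) \<longlonglongrightarrow> expectation g"
    by (rule integral_dominated_convergence[OF _ _ bg])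
      (auto intro!: quantise_tendsto quantise_abs_le)
  moreover have "(\<lambda>n. expectation (\<lambda>x. quantise n (f x) * quantise n (g x)))
      \<longlonglongrightarrow> expectation (\<lambda>x. f x * g x)"
    by (rule integral_dominated_convergence[OF _ _ bfg])
      (use le in \<open>auto intro!: tendsto_mult quantise_tendsto\<close>)
  ultimately show ?thesis
    unfolding covariance_eq[OF iq] covariance_eq[OF int] by (intro tendsto_intros)
qed

lemma (in prob_space) covariance_le_of_layer_bound:
  assumes L: "layer_bound \<zeta> L" and K: "layer_bound \<theta> K"
    and sub: "subalgebra M F" "subalgebra M G"
    and dep: "\<And>A B. A \<in> sets F \<Longrightarrow> B \<in> sets G \<Longrightarrow> prob (A \<inter> B) - prob A * prob B \<le> \<zeta> (prob A) * \<theta> (prob B)"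
    and f: "f \<in> borel_measurable F" "integrable M (\<lambda>x. (f x)\<^sup>2)"
    and g: "g \<in> borel_measurable G" "integrable M (\<lambda>x. (g x)\<^sup>2)"
  shows "covariance M f g \<le> L * K * (std_dev M f * std_dev M g)"
proof (rule LIMSEQ_le)
  have m: "f \<in> borel_measurable M" "g \<in> borel_measurable M"
    using measurable_from_subalg sub f g by blast+
  show "(\<lambda>n. covariance M (\<lambda>x. quantise n (f x)) (\<lambda>x. quantise n (g x))) \<longlonglongrightarrow> covariance M f g"
    by (intro covariance_quantise_tendsto m f g)
  show "(\<lambda>n. L * K * (std_dev M (\<lambda>x. quantise n (f x)) * std_dev M (\<lambda>x. quantise n (g x))))
      \<longlonglongrightarrow> L * K * (std_dev M f * std_dev M g)"
    unfolding std_dev_def by (intro tendsto_intros covariance_quantise_tendsto m f g)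
  have "covariance M (\<lambda>x. quantise n (f x)) (\<lambda>x. quantise n (g x))
      \<le> L * K * (std_dev M (\<lambda>x. quantise n (f x)) * std_dev M (\<lambda>x. quantise n (g x)))" for n
  proof -
    define T where "T k = {real k / real (Suc n) - real (Suc n)..}" for k
    define A where "A k = f -` T k \<inter> space M" for k
    define B where "B k = g -` T k \<inter> space M" for k
    define qf where "qf x = (\<Sum>k\<in>{1..2 * (Suc n)\<^sup>2}. 1 / real (Suc n) * indicator (A k) x) + - real (Suc n)" for x
    define qg where "qg x = (\<Sum>k\<in>{1..2 * (Suc n)\<^sup>2}. 1 / real (Suc n) * indicator (B k) x) + - real (Suc n)" for x
    have T: "T i \<subseteq> T j \<or> T j \<subseteq> T i" for i j by (auto simp: T_def)
    have le: "covariance M qf qg \<le> L * K * (std_dev M qf * std_dev M qg)"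
      unfolding qf_def qg_def
    proof (rule covariance_nested_step_functions_le[OF L K sub dep])
      show "A i \<in> sets F" for i
        using measurable_sets[OF f(1), of "T i"] sub by (simp add: A_def T_def subalgebra_def)
      show "B i \<in> sets G" for i
        using measurable_sets[OF g(1), of "T i"] sub by (simp add: B_def T_def subalgebra_def)
      show "A i \<subseteq> A j \<or> A j \<subseteq> A i" "B i \<subseteq> B j \<or> B j \<subseteq> B i" for i j
        using T[of i j] unfolding A_def B_def by blast+
    qed auto
    have qf: "quantise n (f x) = qf x" and qg: "quantise n (g x) = qg x" if "x \<in> space M" for x
      using that by (simp_all add: quantise_def qf_def qg_def A_def B_def T_def indicator_def)
    \<comment> \<open>Covariance sees only values on \<open>space M\<close>. There \<open>qf\<close>
      and \<open>qg\<close> agree with the quantised functions; outside they need not, as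
      \<open>A k\<close> and \<open>B k\<close> are cut down to \<open>space M\<close>.\<close>
    have cong: "covariance M h k = covariance M h' k'"
      if "\<And>x. x \<in> space M \<Longrightarrow> h x = h' x" "\<And>x. x \<in> space M \<Longrightarrow> k x = k' x" for h h' k k'
      unfolding covariance_def using that by (simp cong: Bochner_Integration.integral_cong)
    have "covariance M (\<lambda>x. quantise n (f x)) (\<lambda>x. quantise n (g x)) = covariance M qf qg"
      "covariance M (\<lambda>x. quantise n (f x)) (\<lambda>x. quantise n (f x)) = covariance M qf qf"
      "covariance M (\<lambda>x. quantise n (g x)) (\<lambda>x. quantise n (g x)) = covariance M qg qg"
      by (rule cong; simp add: qf qg)+
    then show ?thesis using le by (simp add: std_dev_def)
  qed
  then show "\<exists>N. \<forall>n\<ge>N. covariance M (\<lambda>x. quantise n (f x)) (\<lambda>x. quantise n (g x))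
      \<le> L * K * (std_dev M (\<lambda>x. quantise n (f x)) * std_dev M (\<lambda>x. quantise n (g x)))" by blast
qed

section \<open>Maximal correlation and infinite or vanishing norms\<close>

lemma (in prob_space) max_correlation_le_of_layer_bound:
  assumes "layer_bound \<zeta> L" and "layer_bound \<theta> K" and LK: "L \<ge> 0" "K \<ge> 0"
    and "subalgebra M F" "subalgebra M G"
    and "\<And>A B. A \<in> sets F \<Longrightarrow> B \<in> sets G \<Longrightarrow> prob (A \<inter> B) - prob A * prob B \<le> \<zeta> (prob A) * \<theta> (prob B)"
  shows "max_correlation M F G \<le> ennreal (L * K)"
  unfolding max_correlation_def
proof (intro SUP_least, clarify, rule ennreal_leI)
  fix f g assume fg: "f \<in> nonconst_L2 M F" "g \<in> nonconst_L2 M G"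
  note le = covariance_le_of_layer_bound[OF assms(1,2,5-7)]
  have cov: "covariance M f g \<le> L * K * (std_dev M f * std_dev M g)"
    using fg unfolding nonconst_L2_def by (intro le) auto
  \<comment> \<open>The hypothesis is one-sided, but \<open>- f\<close> is measurable for the same
    \<open>F\<close> and so supplies the lower bound.\<close>
  have "covariance M (\<lambda>x. - f x) g \<le> L * K * (std_dev M (\<lambda>x. - f x) * std_dev M g)"
    using fg unfolding nonconst_L2_def by (intro le) auto
  moreover have "covariance M (\<lambda>x. - f x) g = - covariance M f g"
  proof -
    have "(- f x - - expectation f) * (g x - expectation g)
        = - ((f x - expectation f) * (g x - expectation g))" for x
      by (simp add: algebra_simps)
    then show ?thesis unfolding covariance_def by simp
  qed
  moreover have "std_dev M (\<lambda>x. - f x) = std_dev M f"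
  proof -
    have "(- f x - - expectation f) * (- f x - - expectation f)
        = (f x - expectation f) * (f x - expectation f)" for x
      by (simp add: algebra_simps)
    then show ?thesis unfolding std_dev_def covariance_def by simp
  qed
  ultimately have abs: "\<bar>covariance M f g\<bar> \<le> L * K * (std_dev M f * std_dev M g)"
    using cov by simp
  have "std_dev M h \<ge> 0" for h
    unfolding std_dev_def covariance_def by (auto intro!: integral_nonneg_AE)
  then have "std_dev M f * std_dev M g \<ge> 0" by simp
  \<comment> \<open>Division by a zero product yields 0, and \<open>LK\<close> then closes the
    case.\<close>
  then show "\<bar>covariance M f g\<bar> / (std_dev M f * std_dev M g) \<le> L * K"
    using abs LK by (cases "std_dev M f * std_dev M g = 0") (auto simp: pos_divide_le_eq less_le)
qed

text \<open>The norms along a representing sequence converge; their limit is both the norm of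
  \<open>\<zeta>\<close> and a constant for its layer bound.\<close>

lemma h10_norm_finite_layer_bound:
  assumes "h10_norm \<zeta> \<noteq> \<infinity>"
  obtains L where "L \<ge> 0" "h10_norm \<zeta> = ennreal L" "layer_bound \<zeta> L"
proof -
  obtain \<phi> where \<phi>: "h10_represents \<phi> \<zeta>"
    using assms unfolding h10_norm_def by (auto split: if_splits)
  then obtain L where L: "(\<lambda>n. h10_prenorm (\<phi> n)) \<longlonglongrightarrow> L"
    using h10_represents_convergent convergent_def by blast
  have "L \<ge> 0" by (rule LIMSEQ_le_const[OF L]) (auto intro: h10_prenorm_nonneg)
  then show ?thesis using that h10_norm_eq[OF \<phi> L] layer_bound_limit[OF \<phi> L] by blast
qed

theorem theorem2p1p3:
  fixes M F G :: "'a measure" and \<zeta> \<theta> :: "real \<Rightarrow> real"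
  assumes "prob_space M"
    and "subalgebra M F" and "subalgebra M G"
    and "\<zeta> \<in> C00" and "\<theta> \<in> C00"
    and "\<And>A B. A \<in> sets F \<Longrightarrow> B \<in> sets G \<Longrightarrow>
           measure M (A \<inter> B) - measure M A * measure M B \<le> \<zeta> (measure M A) * \<theta> (measure M B)"
  shows "max_correlation M F G \<le> h10_norm \<zeta> * h10_norm \<theta>"
proof -
  interpret prob_space M by fact
  note bound = max_correlation_le_of_layer_bound[OF _ _ _ _ assms(2,3)]
  \<comment> \<open>In \<^typ>\<open>ennreal\<close> we have \<open>0 * \<infinity> = 0\<close>, so a vanishing norm has to be treated separately.\<close>
  have zero: "max_correlation M F G = 0" if z: "h10_norm \<zeta> = 0 \<or> h10_norm \<theta> = 0"
  proof -
    have vanish: "\<eta> x = 0" if "h10_norm \<eta> = 0" "x \<in> {0..1}" for \<eta> x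
    proof -
      have "h10_norm \<eta> \<noteq> \<infinity>" using that(1) by simp
      then obtain L where "L \<ge> 0" "h10_norm \<eta> = ennreal L" "layer_bound \<eta> L"
        by (rule h10_norm_finite_layer_bound)
      then show ?thesis using that layer_bound_0_imp_zero by simp
    qed
    \<comment> \<open>One factor vanishes on \<open>[0,1]\<close>, so the hypothesis holds with both
      functions replaced by zero, even if the other norm is infinite.\<close>
    have "prob (A \<inter> B) - prob A * prob B \<le> 0 * 0" if "A \<in> sets F" "B \<in> sets G" for A B
      using assms(6)[OF that] z vanish[of \<zeta> "prob A"] vanish[of \<theta> "prob B"] by auto
    then have "max_correlation M F G \<le> ennreal (0 * 0)"
      by (intro bound[OF layer_bound_zero layer_bound_zero]) simp_all
    then show ?thesis by simp
  qed
  show ?thesis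
  proof (cases "h10_norm \<zeta> = \<infinity> \<or> h10_norm \<theta> = \<infinity>")
    case True
    then show ?thesis
      using zero by (cases "h10_norm \<zeta> = 0 \<or> h10_norm \<theta> = 0") (auto simp: ennreal_top_mult ennreal_mult_top)
  next
    case False
    obtain L where L: "L \<ge> 0" "h10_norm \<zeta> = ennreal L" "layer_bound \<zeta> L"
      using False h10_norm_finite_layer_bound by blast
    obtain K where K: "K \<ge> 0" "h10_norm \<theta> = ennreal K" "layer_bound \<theta> K"
      using False h10_norm_finite_layer_bound by blast
    have "max_correlation M F G \<le> ennreal (L * K)"
      by (rule bound[OF L(3) K(3) L(1) K(1) assms(6)])
    then show ?thesis
      unfolding L(2) K(2) ennreal_mult[OF L(1) K(1)] .
  qed
qed

end
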